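(* Let $(\mathcal K,r_n)$ be a pre-extender. The symmetry type graph of the universal Cayley extension $\mathcal U(\mathcal K,r_n)$ is isomorphic to $\mathcal K_{r_n}/\heartsuit(\mathcal K,r_n)$.
   Context: An $n$-premaniplex is a graph (semi-edges and parallel edges allowed) whose vertices, called flags, carry a proper edge colouring with colours $0,\dots,n-1$, every flag $\Phi$ having exactly one incident dart of each colour $i$, with other end $r_i\Phi$; one requires $r_ir_jr_ir_j=1$ for $|i-j|>1$. An $n$-maniplex is a connected $n$-premaniplex in which $r_i$ and $r_ir_j$ ($i\neq j$) have no fixed points. Facets are components after deleting colour-$(n-1)$ edges. Automorphisms are colour-preserving graph automorphisms acting on the right; $\Gamma(\cdot)$ denotes the automorphism group. The symmetry type graph of a maniplex $\mathcal M$ is the quotient premaniplex $\mathcal M/\Gamma(\mathcal M)$: vertices are flag orbits, and the orbit of $\Phi$ is $i$-adjacent to the orbit of $r_i\Phi$. A pre-extender $(\mathcal K,r_n)$ is an $n$-maniplex $\mathcal K$ together with a permutation $r_n$ of its flags with $r_n^2=1$ commuting with $r_0,\dots,r_{n-2}$ (so $r_n$ maps each facet $F$ isomorphically onto a facet $r_n(F)$). The pre-extension $\mathcal K_{r_n}$ is the $(n+1)$-premaniplex with the flags and $i$-adjacencies ($i<n$) of $\mathcal K$, where the $n$-adjacent flag of $\Phi$ is $r_n\Phi$. The universal Cayley extension $\mathcal U(\mathcal K,r_n)$ is the maniplex with flags $(\Phi,\gamma)$, $\Phi$ a flag of $\mathcal K$, $\gamma$ in the group $G(\mathcal K,r_n)=\langle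 \alpha_F\ (F \text{ a facet of }\mathcal K) \mid \alpha_F\alpha_{r_n(F)}=1\ \forall F\rangle$, where $(\Phi,\gamma)$ is $i$-adjacent to $(r_i\Phi,\gamma)$ for $i<n$ and $n$-adjacent to $(r_n\Phi,\alpha_F\gamma)$ with $F$ the facet of $\Phi$. A subset $S\subseteq\Gamma(\mathcal K)$ is $r_n$-friendly if for every flag $\Phi$ of $\mathcal K$ and every $\tau\in S$ there is $\bar\tau\in S$ with $r_n(\Phi\tau)=(r_n\Phi)\bar\tau$. $\heartsuit(\mathcal K,r_n)$ denotes the union of all $r_n$-friendly subsets of $\Gamma(\mathcal K)$ (the greatest $r_n$-friendly set; it is a subgroup). For an $r_n$-friendly subgroup $H$, $\mathcal K_{r_n}/H$ is the premaniplex whose vertices are the orbits $\Phi H$, with $\Phi H$ $i$-adjacent to $(r_i\Phi)H$ for $0\le i\le n$ (well defined by friendliness). *)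

theory Defs
  imports "HOL-Algebra.Group" "HOL-Algebra.Bij"
begin

section \<open>Premaniplexes and maniplexes\<close>

text \<open>
  A properly edge-coloured graph in which every flag has exactly one dart of each colour
  is given by its set of flags and, for each colour \<open>i\<close>, the map \<open>adj M i\<close> sending a flag
  to its \<open>i\<close>-adjacent flag; a semi-edge of colour \<open>i\<close> is a fixed point of \<open>adj M i\<close>.
  The number \<open>n\<close> of colours is a separate parameter; \<open>adj M i\<close> is irrelevant for \<open>i \<ge> n\<close>
  and outside \<open>flags M\<close>.
\<close>

record 'a premaniplex =
  flags :: "'a set"
  adj :: "nat \<Rightarrow> 'a \<Rightarrow> 'a"

definition is_premaniplex :: "nat \<Rightarrow> 'a premaniplex \<Rightarrow> bool" where
  "is_premaniplex n M \<longleftrightarrow>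
     (\<forall>i<n. \<forall>\<Phi>\<in>flags M. adj M i \<Phi> \<in> flags M \<and> adj M i (adj M i \<Phi>) = \<Phi>) \<and>
     (\<forall>i<n. \<forall>j<n. \<bar>int i - int j\<bar> > 1 \<longrightarrow>
        (\<forall>\<Phi>\<in>flags M. adj M i (adj M j (adj M i (adj M j \<Phi>))) = \<Phi>))"

definition component :: "nat set \<Rightarrow> 'a premaniplex \<Rightarrow> 'a \<Rightarrow> 'a set" where
  "component I M \<Phi> =
     {\<Psi>. (\<Phi>, \<Psi>) \<in> {(\<Theta>, adj M i \<Theta>) | \<Theta> i. \<Theta> \<in> flags M \<and> i \<in> I}\<^sup>*}"

definition premaniplex_connected :: "nat \<Rightarrow> 'a premaniplex \<Rightarrow> bool" where
  "premaniplex_connected n M \<longleftrightarrow>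
     flags M \<noteq> {} \<and> (\<forall>\<Phi>\<in>flags M. \<forall>\<Psi>\<in>flags M. \<Psi> \<in> component {..<n} M \<Phi>)"

definition is_maniplex :: "nat \<Rightarrow> 'a premaniplex \<Rightarrow> bool" where
  "is_maniplex n M \<longleftrightarrow>
     is_premaniplex n M \<and> premaniplex_connected n M \<and>
     (\<forall>i<n. \<forall>\<Phi>\<in>flags M. adj M i \<Phi> \<noteq> \<Phi>) \<and>
     (\<forall>i<n. \<forall>j<n. i \<noteq> j \<longrightarrow> (\<forall>\<Phi>\<in>flags M. adj M i (adj M j \<Phi>) \<noteq> \<Phi>))"

definition facet_of :: "nat \<Rightarrow> 'a premaniplex \<Rightarrow> 'a \<Rightarrow> 'a set" where
  "facet_of n M \<Phi> = component ({..<n} - {n - 1}) M \<Phi>"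

definition facets :: "nat \<Rightarrow> 'a premaniplex \<Rightarrow> 'a set set" where
  "facets n M = facet_of n M ` flags M"

definition premaniplex_iso ::
    "nat \<Rightarrow> 'a premaniplex \<Rightarrow> 'b premaniplex \<Rightarrow> ('a \<Rightarrow> 'b) \<Rightarrow> bool" where
  "premaniplex_iso n M N f \<longleftrightarrow>
     bij_betw f (flags M) (flags N) \<and>
     (\<forall>i<n. \<forall>\<Phi>\<in>flags M. f (adj M i \<Phi>) = adj N i (f \<Phi>))"

definition premaniplex_isomorphic :: "nat \<Rightarrow> 'a premaniplex \<Rightarrow> 'b premaniplex \<Rightarrow> bool" where
  "premaniplex_isomorphic n M N \<longleftrightarrow> (\<exists>f. premaniplex_iso n M N f)"

text \<open>
  As in \<^const>\<open>BijGroup\<close>, automorphisms are normalised to be undefined outside the flag set.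
  The right action \<open>\<Phi>\<tau>\<close> is written \<open>\<tau> \<Phi>\<close>; only orbits and membership matter below, so the
  order in which automorphisms are multiplied plays no role.
\<close>

definition Aut :: "nat \<Rightarrow> 'a premaniplex \<Rightarrow> ('a \<Rightarrow> 'a) set" where
  "Aut n M = {\<tau> \<in> Bij (flags M). premaniplex_iso n M M \<tau>}"


section \<open>Quotients and symmetry type graphs\<close>

definition orb :: "('a \<Rightarrow> 'a) set \<Rightarrow> 'a \<Rightarrow> 'a set" where
  "orb H \<Phi> = {\<tau> \<Phi> | \<tau>. \<tau> \<in> H}"

text \<open>
  The \<open>i\<close>-neighbour of an orbit is the union of the orbits of the \<open>i\<close>-neighbours of its flags.
  Whenever this orbit does not depend on the representative, it is the orbit of
  \<open>adj M i \<Phi>\<close>; see \<open>adj_quotient_Aut\<close> and \<open>adj_quotient_friendly\<close> below.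
\<close>

definition quotient_premaniplex ::
    "'a premaniplex \<Rightarrow> ('a \<Rightarrow> 'a) set \<Rightarrow> 'a set premaniplex" where
  "quotient_premaniplex M H =
     \<lparr>flags = orb H ` flags M, adj = (\<lambda>i A. \<Union>\<Phi>\<in>A. orb H (adj M i \<Phi>))\<rparr>"

definition symmetry_type_graph :: "nat \<Rightarrow> 'a premaniplex \<Rightarrow> 'a set premaniplex" where
  "symmetry_type_graph n M = quotient_premaniplex M (Aut n M)"


section \<open>Groups given by generators and relators\<close>

text \<open>
  A word is a list of letters, \<open>(True, x)\<close> standing for the generator \<open>x\<close> and \<open>(False, x)\<close>
  for its formal inverse.
\<close>

inductive word_eq :: "'g set \<Rightarrow> (bool \<times> 'g) list set \<Rightarrow>
    (bool \<times> 'g) list \<Rightarrow> (bool \<times> 'g) list \<Rightarrow> bool" for X R where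
  refl: "u \<in> lists (UNIV \<times> X) \<Longrightarrow> word_eq X R u u"
| sym: "word_eq X R u v \<Longrightarrow> word_eq X R v u"
| trans: "word_eq X R u v \<Longrightarrow> word_eq X R v w \<Longrightarrow> word_eq X R u w"
| cancel: "u \<in> lists (UNIV \<times> X) \<Longrightarrow> v \<in> lists (UNIV \<times> X) \<Longrightarrow> x \<in> X \<Longrightarrow>
    word_eq X R (u @ [(b, x), (\<not> b, x)] @ v) (u @ v)"
| relator: "u \<in> lists (UNIV \<times> X) \<Longrightarrow> v \<in> lists (UNIV \<times> X) \<Longrightarrow> r \<in> R \<Longrightarrow> r \<in> lists (UNIV \<times> X) \<Longrightarrow>
    word_eq X R (u @ r @ v) (u @ v)"

definition word_class :: "'g set \<Rightarrow> (bool \<times> 'g) list set \<Rightarrow>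
    (bool \<times> 'g) list \<Rightarrow> (bool \<times> 'g) list set" where
  "word_class X R u = {v. word_eq X R u v}"

definition presented_group ::
    "'g set \<Rightarrow> (bool \<times> 'g) list set \<Rightarrow> (bool \<times> 'g) list set monoid" where
  "presented_group X R =
     \<lparr>carrier = word_class X R ` lists (UNIV \<times> X),
      mult = (\<lambda>A B. \<Union>u\<in>A. \<Union>v\<in>B. word_class X R (u @ v)),
      one = word_class X R []\<rparr>"


section \<open>Pre-extenders and universal Cayley extensions\<close>

definition pre_extender :: "nat \<Rightarrow> 'a premaniplex \<Rightarrow> ('a \<Rightarrow> 'a) \<Rightarrow> bool" where
  "pre_extender n K rn \<longleftrightarrow>
     is_maniplex n K \<and>
     bij_betw rn (flags K) (flags K) \<and>
     (\<forall>\<Phi>\<in>flags K. rn (rn \<Phi>) = \<Phi>) \<and>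
     (\<forall>i. i + 1 < n \<longrightarrow> (\<forall>\<Phi>\<in>flags K. rn (adj K i \<Phi>) = adj K i (rn \<Phi>)))"

definition pre_extension :: "nat \<Rightarrow> 'a premaniplex \<Rightarrow> ('a \<Rightarrow> 'a) \<Rightarrow> 'a premaniplex" where
  "pre_extension n K rn = \<lparr>flags = flags K, adj = (adj K)(n := rn)\<rparr>"

text \<open>The generators are the facets themselves; \<open>rn ` F\<close> is the facet \<open>r\<^sub>n(F)\<close>.\<close>

definition facet_relators ::
    "nat \<Rightarrow> 'a premaniplex \<Rightarrow> ('a \<Rightarrow> 'a) \<Rightarrow> (bool \<times> 'a set) list set" where
  "facet_relators n K rn = {[(True, F), (True, rn ` F)] | F. F \<in> facets n K}"

definition extension_group ::
    "nat \<Rightarrow> 'a premaniplex \<Rightarrow> ('a \<Rightarrow> 'a) \<Rightarrow> (bool \<times> 'a set) list set monoid" where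
  "extension_group n K rn = presented_group (facets n K) (facet_relators n K rn)"

definition facet_generator ::
    "nat \<Rightarrow> 'a premaniplex \<Rightarrow> ('a \<Rightarrow> 'a) \<Rightarrow> 'a set \<Rightarrow> (bool \<times> 'a set) list set" where
  "facet_generator n K rn F = word_class (facets n K) (facet_relators n K rn) [(True, F)]"

definition universal_Cayley_extension ::
    "nat \<Rightarrow> 'a premaniplex \<Rightarrow> ('a \<Rightarrow> 'a) \<Rightarrow> ('a \<times> (bool \<times> 'a set) list set) premaniplex" where
  "universal_Cayley_extension n K rn =
     \<lparr>flags = flags K \<times> carrier (extension_group n K rn),
      adj = (\<lambda>i (\<Phi>, \<gamma>).
        if i = n
        then (rn \<Phi>, facet_generator n K rn (facet_of n K \<Phi>) \<otimes>\<^bsub>extension_group n K rn\<^esub> \<gamma>)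
        else (adj K i \<Phi>, \<gamma>))\<rparr>"

definition friendly :: "nat \<Rightarrow> 'a premaniplex \<Rightarrow> ('a \<Rightarrow> 'a) \<Rightarrow> ('a \<Rightarrow> 'a) set \<Rightarrow> bool" where
  "friendly n K rn S \<longleftrightarrow>
     S \<subseteq> Aut n K \<and>
     (\<forall>\<Phi>\<in>flags K. \<forall>\<tau>\<in>S. \<exists>\<tau>'\<in>S. rn (\<tau> \<Phi>) = \<tau>' (rn \<Phi>))"

definition heartsuit :: "nat \<Rightarrow> 'a premaniplex \<Rightarrow> ('a \<Rightarrow> 'a) \<Rightarrow> ('a \<Rightarrow> 'a) set" where
  "heartsuit n K rn = \<Union>{S. friendly n K rn S}"


section \<open>Basic well-definedness facts\<close>

lemma word_eq_words:
  "word_eq X R u v \<Longrightarrow> u \<in> lists (UNIV \<times> X) \<and> v \<in> lists (UNIV \<times> X)"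
  by (induction rule: word_eq.induct) auto

lemma word_eq_append_left:
  "word_eq X R u v \<Longrightarrow> w \<in> lists (UNIV \<times> X) \<Longrightarrow> word_eq X R (w @ u) (w @ v)"
proof (induction rule: word_eq.induct)
  case (cancel u v x b)
  then show ?case using word_eq.cancel[of "w @ u" X v x R b] by simp
next
  case (relator u v r)
  then show ?case using word_eq.relator[of "w @ u" X v r R] by simp
qed (auto intro: word_eq.sym word_eq.trans intro!: word_eq.refl simp del: in_lists_conv_set)

lemma word_eq_append_right:
  "word_eq X R u v \<Longrightarrow> w \<in> lists (UNIV \<times> X) \<Longrightarrow> word_eq X R (u @ w) (v @ w)"
proof (induction rule: word_eq.induct)
  case (cancel u v x b)
  then show ?case using word_eq.cancel[of u X "v @ w" x R b] by simp
next
  case (relator u v r)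
  then show ?case using word_eq.relator[of u X "v @ w" r R] by simp
qed (auto intro: word_eq.sym word_eq.trans intro!: word_eq.refl simp del: in_lists_conv_set)

lemma word_eq_append:
  assumes "word_eq X R u u'" "word_eq X R v v'"
  shows "word_eq X R (u @ v) (u' @ v')"
  using word_eq_append_right[OF assms(1)] word_eq_append_left[OF assms(2)]
    word_eq_words[OF assms(1)] word_eq_words[OF assms(2)] word_eq.trans by blast

lemma word_class_eq: "word_eq X R u v \<Longrightarrow> word_class X R u = word_class X R v"
  unfolding word_class_def by (blast intro: word_eq.sym word_eq.trans)

lemma mult_word_class:
  assumes "u \<in> lists (UNIV \<times> X)" "v \<in> lists (UNIV \<times> X)"
  shows "word_class X R u \<otimes>\<^bsub>presented_group X R\<^esub> word_class X R v = word_class X R (u @ v)"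
proof -
  have "word_class X R (u' @ v') = word_class X R (u @ v)"
    if "u' \<in> word_class X R u" "v' \<in> word_class X R v" for u' v'
  proof (rule word_class_eq[OF word_eq.sym])
    show "word_eq X R (u @ v) (u' @ v')"
      using that by (intro word_eq_append) (simp_all add: word_class_def)
  qed
  moreover have "u \<in> word_class X R u" "v \<in> word_class X R v"
    using assms by (simp_all add: word_class_def word_eq.refl del: in_lists_conv_set)
  ultimately have "(\<Union>u'\<in>word_class X R u. \<Union>v'\<in>word_class X R v. word_class X R (u' @ v')) =
      word_class X R (u @ v)"
    by fast
  then show ?thesis by (simp add: presented_group_def)
qed

lemma word_inverse:
  assumes "u \<in> lists (UNIV \<times> X)"
  shows "\<exists>v \<in> lists (UNIV \<times> X). word_eq X R (v @ u) []"
  using assms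
proof (induction u)
  case Nil
  then show ?case by (auto intro!: bexI[of _ "[]"] word_eq.refl)
next
  case (Cons a u)
  obtain b x where a: "a = (b, x)" by (cases a)
  with Cons have x: "x \<in> X" and u: "u \<in> lists (UNIV \<times> X)" by auto
  with Cons obtain v where v: "v \<in> lists (UNIV \<times> X)" "word_eq X R (v @ u) []" by auto
  have "word_eq X R (v @ [(\<not> b, x), (\<not> \<not> b, x)] @ u) (v @ u)"
    using v u x by (intro word_eq.cancel)
  then have "word_eq X R ((v @ [(\<not> b, x)]) @ a # u) []"
    using v(2) a by (auto intro: word_eq.trans)
  then show ?case using v x by (intro bexI[of _ "v @ [(\<not> b, x)]"]) auto
qed

lemma group_presented_group: "group (presented_group X R)"
proof (rule groupI)
  fix x y assume "x \<in> carrier (presented_group X R)" "y \<in> carrier (presented_group X R)"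
  then obtain u v where "x = word_class X R u" "u \<in> lists (UNIV \<times> X)"
    "y = word_class X R v" "v \<in> lists (UNIV \<times> X)"
    by (auto simp: presented_group_def simp del: in_lists_conv_set)
  then show "x \<otimes>\<^bsub>presented_group X R\<^esub> y \<in> carrier (presented_group X R)"
    by (simp add: mult_word_class) (auto simp: presented_group_def simp del: in_lists_conv_set)
next
  show "\<one>\<^bsub>presented_group X R\<^esub> \<in> carrier (presented_group X R)"
    by (auto simp: presented_group_def)
next
  fix x y z
  assume "x \<in> carrier (presented_group X R)" "y \<in> carrier (presented_group X R)"
    "z \<in> carrier (presented_group X R)"
  then obtain u v w where "x = word_class X R u" "u \<in> lists (UNIV \<times> X)"
    "y = word_class X R v" "v \<in> lists (UNIV \<times> X)"
    "z = word_class X R w" "w \<in> lists (UNIV \<times> X)"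
    by (auto simp: presented_group_def simp del: in_lists_conv_set)
  then show "x \<otimes>\<^bsub>presented_group X R\<^esub> y \<otimes>\<^bsub>presented_group X R\<^esub> z =
      x \<otimes>\<^bsub>presented_group X R\<^esub> (y \<otimes>\<^bsub>presented_group X R\<^esub> z)"
    by (simp add: mult_word_class del: in_lists_conv_set)
next
  fix x assume "x \<in> carrier (presented_group X R)"
  then obtain u where u: "x = word_class X R u" "u \<in> lists (UNIV \<times> X)"
    by (auto simp: presented_group_def)
  have one: "\<one>\<^bsub>presented_group X R\<^esub> = word_class X R []" by (simp add: presented_group_def)
  show "\<one>\<^bsub>presented_group X R\<^esub> \<otimes>\<^bsub>presented_group X R\<^esub> x = x"
    using u by (simp add: one mult_word_class)
  obtain v where v: "v \<in> lists (UNIV \<times> X)" "word_eq X R (v @ u) []"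
    using word_inverse[OF u(2)] by blast
  have "word_class X R v \<otimes>\<^bsub>presented_group X R\<^esub> x = \<one>\<^bsub>presented_group X R\<^esub>"
    using u v word_class_eq[OF v(2)] by (simp add: one mult_word_class)
  then show "\<exists>y\<in>carrier (presented_group X R).
      y \<otimes>\<^bsub>presented_group X R\<^esub> x = \<one>\<^bsub>presented_group X R\<^esub>"
    using v by (auto simp: presented_group_def)
qed

lemma subgroup_Aut:
  assumes "is_premaniplex n M"
  shows "subgroup (Aut n M) (BijGroup (flags M))"
proof -
  interpret group "BijGroup (flags M)" by (rule group_BijGroup)
  have closed: "\<And>i \<Phi>. i < n \<Longrightarrow> \<Phi> \<in> flags M \<Longrightarrow> adj M i \<Phi> \<in> flags M"
    using assms by (auto simp: is_premaniplex_def)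
  show ?thesis
  proof (rule subgroupI)
    show "Aut n M \<subseteq> carrier (BijGroup (flags M))"
      by (auto simp: Aut_def BijGroup_def)
    have "(\<lambda>x\<in>flags M. x) \<in> Aut n M"
      using closed id_Bij[of "flags M"] by (auto simp: Aut_def premaniplex_iso_def Bij_def)
    then show "Aut n M \<noteq> {}" by blast
  next
    fix a assume a: "a \<in> Aut n M"
    then have aB: "a \<in> Bij (flags M)" and bij: "bij_betw a (flags M) (flags M)"
      and hom: "\<And>i \<Phi>. i < n \<Longrightarrow> \<Phi> \<in> flags M \<Longrightarrow> a (adj M i \<Phi>) = adj M i (a \<Phi>)"
      by (auto simp: Aut_def premaniplex_iso_def)
    define b where "b = (\<lambda>x\<in>flags M. inv_into (flags M) a x)"
    have bB: "b \<in> Bij (flags M)" using restrict_inv_into_Bij[OF aB] by (simp add: b_def)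
    have ab: "a (b \<Phi>) = \<Phi>" "b \<Phi> \<in> flags M" if "\<Phi> \<in> flags M" for \<Phi>
      using that bij by (auto simp: b_def bij_betw_def f_inv_into_f inv_into_into)
    have inj: "inj_on a (flags M)" using bij by (simp add: bij_betw_def)
    have "b (adj M i \<Phi>) = adj M i (b \<Phi>)" if "i < n" "\<Phi> \<in> flags M" for i \<Phi>
      by (rule inj_onD[OF inj]) (use that ab hom closed in auto)
    then have "b \<in> Aut n M" using bB by (auto simp: Aut_def premaniplex_iso_def Bij_def)
    then show "inv\<^bsub>BijGroup (flags M)\<^esub> a \<in> Aut n M"
      using aB by (simp add: inv_BijGroup b_def)
  next
    fix a b assume a: "a \<in> Aut n M" and b: "b \<in> Aut n M"
    then have "compose (flags M) a b \<in> Bij (flags M)"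
      by (auto simp: Aut_def intro: compose_Bij)
    moreover have "b \<Phi> \<in> flags M" if "\<Phi> \<in> flags M" for \<Phi>
      using b that by (auto simp: Aut_def premaniplex_iso_def bij_betw_def)
    ultimately have "compose (flags M) a b \<in> Aut n M"
      using a b closed by (auto simp: Aut_def premaniplex_iso_def compose_def Bij_def)
    then show "a \<otimes>\<^bsub>BijGroup (flags M)\<^esub> b \<in> Aut n M"
      using a b by (auto simp: BijGroup_def Aut_def)
  qed
qed

lemma friendly_heartsuit: "friendly n K rn (heartsuit n K rn)"
  unfolding heartsuit_def friendly_def by blast

lemma orb_eq:
  assumes H: "subgroup H (BijGroup V)" and "\<Phi> \<in> V" "\<Psi> \<in> orb H \<Phi>"
  shows "orb H \<Psi> = orb H \<Phi>"
proof -
  interpret group "BijGroup V" by (rule group_BijGroup)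
  obtain \<tau> where \<tau>: "\<tau> \<in> H" "\<Psi> = \<tau> \<Phi>" using assms by (auto simp: orb_def)
  have sub: "H \<subseteq> Bij V" using subgroup.subset[OF H] by (simp add: BijGroup_def)
  have comp: "compose V \<sigma> \<rho> \<in> H" if "\<sigma> \<in> H" "\<rho> \<in> H" for \<sigma> \<rho>
    using subgroup.m_closed[OF H that] that sub by (simp add: BijGroup_def subset_iff)
  have bij: "bij_betw \<tau> V V" using \<tau> sub by (auto simp: Bij_def)
  define \<rho> where "\<rho> = (\<lambda>x\<in>V. inv_into V \<tau> x)"
  have \<rho>: "\<rho> \<in> H"
    using subgroup.m_inv_closed[OF H \<tau>(1)] \<tau> sub by (auto simp: inv_BijGroup \<rho>_def)
  have \<Psi>: "\<Psi> \<in> V" using \<tau> bij assms by (auto simp: bij_betw_def)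
  have \<rho>\<Psi>: "\<rho> \<Psi> = \<Phi>" using \<Psi> \<tau> bij assms by (auto simp: \<rho>_def bij_betw_def)
  show ?thesis
  proof (intro Set.set_eqI iffI)
    fix x assume "x \<in> orb H \<Psi>"
    then obtain \<sigma> where "\<sigma> \<in> H" "x = \<sigma> \<Psi>" by (auto simp: orb_def)
    then show "x \<in> orb H \<Phi>" using comp[of \<sigma> \<tau>] \<tau> assms(2)
      by (auto simp: orb_def compose_def intro!: exI[of _ "compose V \<sigma> \<tau>"])
  next
    fix x assume "x \<in> orb H \<Phi>"
    then obtain \<sigma> where "\<sigma> \<in> H" "x = \<sigma> \<Phi>" by (auto simp: orb_def)
    then show "x \<in> orb H \<Psi>" using comp[of \<sigma> \<rho>] \<rho> \<rho>\<Psi> \<Psi>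
      by (auto simp: orb_def compose_def intro!: exI[of _ "compose V \<sigma> \<rho>"])
  qed
qed

lemma adj_quotient:
  assumes H: "subgroup H (BijGroup (flags M))" and \<Phi>: "\<Phi> \<in> flags M"
    and closed: "adj M i \<Phi> \<in> flags M"
    and compat: "\<And>\<tau>. \<tau> \<in> H \<Longrightarrow> \<exists>\<tau>'\<in>H. adj M i (\<tau> \<Phi>) = \<tau>' (adj M i \<Phi>)"
  shows "adj (quotient_premaniplex M H) i (orb H \<Phi>) = orb H (adj M i \<Phi>)"
proof -
  have "orb H (adj M i \<Psi>) = orb H (adj M i \<Phi>)" if \<Psi>: "\<Psi> \<in> orb H \<Phi>" for \<Psi>
  proof -
    obtain \<tau> where "\<tau> \<in> H" "\<Psi> = \<tau> \<Phi>" using \<Psi> by (auto simp: orb_def)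
    then have "adj M i \<Psi> \<in> orb H (adj M i \<Phi>)" using compat by (auto simp: orb_def)
    then show ?thesis using orb_eq[OF H closed] by blast
  qed
  moreover have "orb H \<Phi> \<noteq> {}"
    using subgroup.one_closed[OF H] by (auto simp: orb_def)
  ultimately show ?thesis by (auto simp: quotient_premaniplex_def)
qed

lemma adj_quotient_Aut:
  assumes "is_premaniplex n M" "i < n" "\<Phi> \<in> flags M"
  shows "adj (symmetry_type_graph n M) i (orb (Aut n M) \<Phi>) = orb (Aut n M) (adj M i \<Phi>)"
  unfolding symmetry_type_graph_def
proof (rule adj_quotient)
  show "\<exists>\<tau>'\<in>Aut n M. adj M i (\<tau> \<Phi>) = \<tau>' (adj M i \<Phi>)" if "\<tau> \<in> Aut n M" for \<tau>
    using that assms by (intro bexI[of _ \<tau>]) (auto simp: Aut_def premaniplex_iso_def)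
qed (use assms subgroup_Aut in \<open>auto simp: is_premaniplex_def\<close>)

lemma adj_quotient_friendly:
  assumes "pre_extender n K rn" "friendly n K rn H" "subgroup H (BijGroup (flags K))"
    "i \<le> n" "\<Phi> \<in> flags K"
  shows "adj (quotient_premaniplex (pre_extension n K rn) H) i (orb H \<Phi>)
         = orb H (adj (pre_extension n K rn) i \<Phi>)"
proof (rule adj_quotient)
  show "\<exists>\<tau>'\<in>H. adj (pre_extension n K rn) i (\<tau> \<Phi>) = \<tau>' (adj (pre_extension n K rn) i \<Phi>)"
    if \<tau>: "\<tau> \<in> H" for \<tau>
  proof (cases "i = n")
    case True
    then show ?thesis using assms \<tau> by (auto simp: friendly_def pre_extension_def)
  next
    case False
    then have "adj K i (\<tau> \<Phi>) = \<tau> (adj K i \<Phi>)"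
      using assms \<tau> by (auto simp: friendly_def Aut_def premaniplex_iso_def)
    then show ?thesis using False \<tau> by (auto simp: pre_extension_def)
  qed
  show "adj (pre_extension n K rn) i \<Phi> \<in> flags (pre_extension n K rn)"
    using assms by (auto simp: pre_extension_def pre_extender_def is_maniplex_def
        is_premaniplex_def bij_betw_def)
qed (use assms in \<open>auto simp: pre_extension_def\<close>)

lemma subgroup_heartsuit:
  assumes "pre_extender n K rn"
  shows "subgroup (heartsuit n K rn) (BijGroup (flags K))"
proof -
  let ?V = "flags K"
  have M: "is_premaniplex n K" and rn: "bij_betw rn ?V ?V" "\<And>\<Phi>. \<Phi> \<in> ?V \<Longrightarrow> rn (rn \<Phi>) = \<Phi>"
    using assms by (auto simp: pre_extender_def is_maniplex_def)
  have rnV: "\<And>\<Phi>. \<Phi> \<in> ?V \<Longrightarrow> rn \<Phi> \<in> ?V" using rn by (auto simp: bij_betw_def)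
  interpret B: group "BijGroup ?V" by (rule group_BijGroup)
  note A = subgroup_Aut[OF M]
  let ?H = "heartsuit n K rn"
  have HA: "?H \<subseteq> Aut n K" using friendly_heartsuit by (auto simp: friendly_def)
  have AB: "Aut n K \<subseteq> Bij ?V" by (auto simp: Aut_def)
  have AV: "\<tau> \<Phi> \<in> ?V" if "\<tau> \<in> Aut n K" "\<Phi> \<in> ?V" for \<tau> \<Phi>
    using that by (auto simp: Aut_def premaniplex_iso_def bij_betw_def)
  have step: "\<exists>\<tau>'\<in>?H. rn (\<tau> \<Phi>) = \<tau>' (rn \<Phi>)" if "\<Phi> \<in> ?V" "\<tau> \<in> ?H" for \<Phi> \<tau>
    using friendly_heartsuit that by (fastforce simp: friendly_def)
  have max: "S \<subseteq> ?H" if "friendly n K rn S" for S using that by (auto simp: heartsuit_def)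
  have mult: "a \<otimes>\<^bsub>BijGroup ?V\<^esub> b = compose ?V a b" if "a \<in> Aut n K" "b \<in> Aut n K" for a b
    using that AB by (auto simp: BijGroup_def)
  have inv: "inv\<^bsub>BijGroup ?V\<^esub> a = (\<lambda>x\<in>?V. inv_into ?V a x)" if "a \<in> Aut n K" for a
    using that AB by (auto simp: inv_BijGroup)
  show ?thesis
  proof (rule B.subgroupI)
    show "?H \<subseteq> carrier (BijGroup ?V)" using HA AB by (auto simp: BijGroup_def)
    have "friendly n K rn {\<lambda>x\<in>?V. x}"
      using subgroup.one_closed[OF A] rnV by (auto simp: friendly_def BijGroup_def)
    then show "?H \<noteq> {}" using max by blast
  next
    fix a b assume a: "a \<in> ?H" and b: "b \<in> ?H"
    let ?S = "{compose ?V a b | a b. a \<in> ?H \<and> b \<in> ?H}"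
    have "friendly n K rn ?S"
      unfolding friendly_def
    proof (intro conjI ballI)
      show "?S \<subseteq> Aut n K"
        using subgroup.m_closed[OF A] mult HA by fastforce
      fix \<Phi> \<tau> assume \<Phi>: "\<Phi> \<in> ?V" and "\<tau> \<in> ?S"
      then obtain a b where ab: "a \<in> ?H" "b \<in> ?H" "\<tau> = compose ?V a b" by blast
      obtain b' where b': "b' \<in> ?H" "rn (b \<Phi>) = b' (rn \<Phi>)" using step \<Phi> ab by blast
      obtain a' where a': "a' \<in> ?H" "rn (a (b \<Phi>)) = a' (rn (b \<Phi>))"
        using step[of "b \<Phi>" a] AV HA \<Phi> ab by blast
      have "rn (\<tau> \<Phi>) = compose ?V a' b' (rn \<Phi>)"
        using ab a' b' \<Phi> rnV by (simp add: compose_def)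
      then show "\<exists>\<tau>'\<in>?S. rn (\<tau> \<Phi>) = \<tau>' (rn \<Phi>)" using a' b' by blast
    qed
    then have "compose ?V a b \<in> ?H" using max a b by blast
    then show "a \<otimes>\<^bsub>BijGroup ?V\<^esub> b \<in> ?H" using mult[of a b] a b HA by (simp add: subset_iff)
  next
    fix a assume a: "a \<in> ?H"
    let ?inv = "\<lambda>a. \<lambda>x\<in>?V. inv_into ?V a x"
    have "friendly n K rn (?inv ` ?H)"
      unfolding friendly_def
    proof (intro conjI ballI)
      show "?inv ` ?H \<subseteq> Aut n K"
        using subgroup.m_inv_closed[OF A] inv HA by fastforce
      fix \<Phi> \<tau> assume \<Phi>: "\<Phi> \<in> ?V" and "\<tau> \<in> ?inv ` ?H"
      then obtain a where a: "a \<in> ?H" "\<tau> = ?inv a" by blast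
      have bij: "bij_betw a ?V ?V" using a HA AB by (auto simp: Bij_def)
      have \<Psi>: "\<tau> \<Phi> \<in> ?V" "a (\<tau> \<Phi>) = \<Phi>"
        using bij \<Phi> a by (auto simp: bij_betw_def inv_into_into f_inv_into_f)
      obtain a' where a': "a' \<in> ?H" "rn (a (\<tau> \<Phi>)) = a' (rn (\<tau> \<Phi>))" using step \<Psi> a by blast
      have bij': "inj_on a' ?V" using a' HA AB by (auto simp: Bij_def bij_betw_def)
      have "rn (\<tau> \<Phi>) = ?inv a' (rn \<Phi>)"
        using a' \<Psi> rnV[OF \<Phi>] rnV[OF \<Psi>(1)] bij' by (simp add: inv_into_f_f)
      then show "\<exists>\<tau>'\<in>?inv ` ?H. rn (\<tau> \<Phi>) = \<tau>' (rn \<Phi>)" using a' by blast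
    qed
    then show "inv\<^bsub>BijGroup ?V\<^esub> a \<in> ?H" using max a inv[of a] HA by (auto simp: subset_iff image_subset_iff)
  qed
qed

end

theory Submission
  imports Defs
begin

text \<open>
  An automorphism \<open>\<omega>\<close> of \<open>\<U>(\<K>, r\<^sub>n)\<close> permutes the copies \<open>\<K> \<times> {\<gamma>}\<close> of \<open>\<K>\<close>, and restricting
  it to each copy gives automorphisms of \<open>\<K>\<close> that together form an \<open>r\<^sub>n\<close>-friendly set, because
  \<open>\<omega>\<close> respects the \<open>n\<close>-edges between neighbouring copies. Conversely, an element of \<open>\<heartsuit>(\<K>, r\<^sub>n)\<close>
  and a target copy determine an automorphism of \<open>\<U>\<close>: crossing the facet \<open>F\<close> turns a pair
  \<open>(\<tau>, \<delta>)\<close> into \<open>(\<tau>', \<alpha>\<^bsub>F\<tau>\<^esub> \<delta>)\<close>, where \<open>(r\<^sub>n \<Phi>)\<tau>' = r\<^sub>n (\<Phi>\<tau>)\<close> for \<open>\<Phi> \<in> F\<close>, and these moves satisfy the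
  defining relations of the group. Hence the orbit of \<open>(\<Phi>, \<gamma>)\<close> is the orbit of \<open>\<Phi>\<close> times the
  whole group, and projection to the first factor is the required isomorphism.
\<close>

section \<open>Endomorphisms of connected premaniplexes\<close>

lemma component_induct [consumes 1, case_names base step]:
  assumes "\<Psi> \<in> component I M \<Phi>" and "P \<Phi>"
    and "\<And>i \<Theta>. i \<in> I \<Longrightarrow> \<Theta> \<in> flags M \<Longrightarrow> P \<Theta> \<Longrightarrow> P (adj M i \<Theta>)"
  shows "P \<Psi>"
  using assms(1) unfolding component_def mem_Collect_eq
  by (induction rule: rtrancl_induct) (use assms(2,3) in auto)

lemma component_refl: "\<Phi> \<in> component I M \<Phi>"
  by (simp add: component_def)

lemma component_step:
  assumes "\<Psi> \<in> component I M \<Phi>" "\<Psi> \<in> flags M" "i \<in> I"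
  shows "adj M i \<Psi> \<in> component I M \<Phi>"
  using assms unfolding component_def mem_Collect_eq by (blast intro: rtrancl_into_rtrancl)

lemma component_flags:
  assumes "\<Psi> \<in> component I M \<Phi>" "\<Phi> \<in> flags M"
    and "\<And>i \<Theta>. i \<in> I \<Longrightarrow> \<Theta> \<in> flags M \<Longrightarrow> adj M i \<Theta> \<in> flags M"
  shows "\<Psi> \<in> flags M"
  using assms(1) by (induction rule: component_induct) (use assms(2,3) in auto)

text \<open>\<open>component\<close> follows directed steps; the involution hypothesis supplies the
  way back.\<close>

lemma component_adj:
  assumes "\<Phi> \<in> flags M" "i \<in> I" "adj M i \<Phi> \<in> flags M" "adj M i (adj M i \<Phi>) = \<Phi>"
  shows "component I M (adj M i \<Phi>) = component I M \<Phi>"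
proof -
  let ?r = "{(\<Theta>, adj M i \<Theta>) | \<Theta> i. \<Theta> \<in> flags M \<and> i \<in> I}"
  have "(\<Phi>, adj M i \<Phi>) \<in> ?r" using assms by blast
  moreover have "(adj M i \<Phi>, adj M i (adj M i \<Phi>)) \<in> ?r" using assms by blast
  then have "(adj M i \<Phi>, \<Phi>) \<in> ?r" using assms(4) by simp
  ultimately show ?thesis
    unfolding component_def by (blast intro: converse_rtrancl_into_rtrancl)
qed

lemma component_image:
  assumes "\<Phi> \<in> flags M"
    and closed: "\<And>i \<Theta>. i \<in> I \<Longrightarrow> \<Theta> \<in> flags M \<Longrightarrow> adj M i \<Theta> \<in> flags M"
    and f: "f ` flags M \<subseteq> flags M"
    and comm: "\<And>i \<Theta>. i \<in> I \<Longrightarrow> \<Theta> \<in> flags M \<Longrightarrow> f (adj M i \<Theta>) = adj M i (f \<Theta>)"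
  shows "f ` component I M \<Phi> = component I M (f \<Phi>)"
proof (intro equalityI subsetI)
  have "f \<Theta> \<in> component I M (f \<Phi>)" if "\<Theta> \<in> component I M \<Phi>" for \<Theta>
    using that
  proof (induction rule: component_induct)
    case base
    then show ?case by (rule component_refl)
  next
    case (step i \<Theta>)
    then show ?case using f comm component_step[OF step(3) _ step(1)] by (simp add: image_subset_iff)
  qed
  then show "\<Psi> \<in> component I M (f \<Phi>)" if "\<Psi> \<in> f ` component I M \<Phi>" for \<Psi>
    using that by blast
next
  fix \<Psi> assume "\<Psi> \<in> component I M (f \<Phi>)"
  then show "\<Psi> \<in> f ` component I M \<Phi>"
  proof (induction rule: component_induct)
    case base
    then show ?case by (simp add: component_refl)
  next
    case (step i \<Theta>)
    then obtain \<Xi> where \<Xi>: "\<Xi> \<in> component I M \<Phi>" "\<Theta> = f \<Xi>" by blast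
    then have "\<Xi> \<in> flags M" using component_flags closed assms(1) by metis
    then have "adj M i \<Theta> = f (adj M i \<Xi>)" using comm step(1) \<Xi>(2) by simp
    then show ?case using component_step[OF \<Xi>(1) \<open>\<Xi> \<in> flags M\<close> step(1)] by blast
  qed
qed

lemma connected_induct:
  assumes "premaniplex_connected n M" "\<Phi> \<in> flags M" "P \<Phi>" "\<Psi> \<in> flags M"
    and "\<And>i \<Theta>. i < n \<Longrightarrow> \<Theta> \<in> flags M \<Longrightarrow> P \<Theta> \<Longrightarrow> P (adj M i \<Theta>)"
  shows "P \<Psi>"
proof -
  have "\<Psi> \<in> component {..<n} M \<Phi>" using assms by (auto simp: premaniplex_connected_def)
  then show ?thesis by (induction rule: component_induct) (use assms in auto)
qed

text \<open>Bijectivity is left out so that restrictions and lifts can be built first;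
  \<open>endo_restrict_Aut\<close> recovers it afterwards.\<close>

definition premaniplex_endo :: "nat \<Rightarrow> 'a premaniplex \<Rightarrow> ('a \<Rightarrow> 'a) \<Rightarrow> bool" where
  "premaniplex_endo n M f \<longleftrightarrow>
     f ` flags M \<subseteq> flags M \<and> (\<forall>i<n. \<forall>\<Phi>\<in>flags M. f (adj M i \<Phi>) = adj M i (f \<Phi>))"

lemma Aut_endo: "\<tau> \<in> Aut n M \<Longrightarrow> premaniplex_endo n M \<tau>"
  by (auto simp: Aut_def premaniplex_iso_def premaniplex_endo_def bij_betw_def)

lemma endo_compose:
  "premaniplex_endo n M f \<Longrightarrow> premaniplex_endo n M g \<Longrightarrow> premaniplex_endo n M (\<lambda>x. f (g x))"
  by (auto simp: premaniplex_endo_def image_subset_iff)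

text \<open>Agreement propagates along every edge, so one value determines the whole map.\<close>

lemma endo_eq:
  assumes conn: "premaniplex_connected n M"
    and f: "premaniplex_endo n M f" and g: "premaniplex_endo n M g"
    and \<Phi>: "\<Phi> \<in> flags M" "f \<Phi> = g \<Phi>" and \<Psi>: "\<Psi> \<in> flags M"
  shows "f \<Psi> = g \<Psi>"
  using conn \<Phi> \<Psi> by (rule connected_induct) (use f g in \<open>auto simp: premaniplex_endo_def\<close>)

lemma Aut_eq:
  assumes "premaniplex_connected n M" "\<sigma> \<in> Aut n M" "\<tau> \<in> Aut n M" "\<Phi> \<in> flags M" "\<sigma> \<Phi> = \<tau> \<Phi>"
  shows "\<sigma> = \<tau>"
proof (rule extensionalityI)
  show "\<sigma> \<in> extensional (flags M)" "\<tau> \<in> extensional (flags M)"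
    using assms by (auto simp: Aut_def Bij_def)
  show "\<sigma> \<Psi> = \<tau> \<Psi>" if "\<Psi> \<in> flags M" for \<Psi>
    using endo_eq[OF assms(1) Aut_endo[OF assms(2)] Aut_endo[OF assms(3)] assms(4,5) that] .
qed

text \<open>By connectedness, \<open>g \<circ> f\<close> and \<open>f \<circ> g\<close> are identities as soon as each fixes one flag.\<close>

lemma endo_restrict_Aut:
  assumes conn: "premaniplex_connected n M"
    and closed: "\<And>i \<Theta>. i < n \<Longrightarrow> \<Theta> \<in> flags M \<Longrightarrow> adj M i \<Theta> \<in> flags M"
    and f: "premaniplex_endo n M f" and g: "premaniplex_endo n M g"
    and \<Phi>: "\<Phi> \<in> flags M" "g (f \<Phi>) = \<Phi>"
  shows "restrict f (flags M) \<in> Aut n M"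
proof -
  have id: "premaniplex_endo n M (\<lambda>x. x)" by (simp add: premaniplex_endo_def)
  have f\<Phi>: "f \<Phi> \<in> flags M" using f \<Phi> by (auto simp: premaniplex_endo_def)
  have "g (f \<Psi>) = \<Psi>" if "\<Psi> \<in> flags M" for \<Psi>
    using endo_eq[OF conn endo_compose[OF g f] id \<Phi> that] .
  moreover have "f (g \<Psi>) = \<Psi>" if "\<Psi> \<in> flags M" for \<Psi>
    using endo_eq[OF conn endo_compose[OF f g] id f\<Phi> _ that] \<Phi> by simp
  ultimately have "bij_betw f (flags M) (flags M)"
    using f g by (intro bij_betw_byWitness[where f' = g]) (auto simp: premaniplex_endo_def)
  then show ?thesis
    using f closed by (auto simp: Aut_def Bij_def premaniplex_iso_def premaniplex_endo_def
        cong: bij_betw_cong)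
qed


section \<open>Actions of presented groups\<close>

lemma foldr_closed:
  assumes "\<And>a s. a \<in> A \<Longrightarrow> s \<in> S \<Longrightarrow> h a s \<in> S" and "u \<in> lists A" "s \<in> S"
  shows "foldr h u s \<in> S"
  using assms(2) by (induction u) (use assms in auto)

text \<open>An elementary rewriting inserts or deletes a subword acting trivially on
  \<open>S\<close>. The letters to its right act first and keep the state in \<open>S\<close>; those
  to its left then act on equal states.\<close>

lemma word_eq_foldr:
  assumes "word_eq X R u v"
    and closed: "\<And>a s. a \<in> UNIV \<times> X \<Longrightarrow> s \<in> S \<Longrightarrow> h a s \<in> S"
    and cancel: "\<And>b x s. x \<in> X \<Longrightarrow> s \<in> S \<Longrightarrow> h (b, x) (h (\<not> b, x) s) = s"
    and relator: "\<And>r s. r \<in> R \<Longrightarrow> s \<in> S \<Longrightarrow> foldr h r s = s"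
    and "s \<in> S"
  shows "foldr h u s = foldr h v s"
  using assms(1)
proof (induction rule: word_eq.induct)
  case (cancel u v x b)
  have "foldr h v s \<in> S" using foldr_closed[of "UNIV \<times> X" S h v s] closed cancel \<open>s \<in> S\<close> by blast
  then show ?case using assms(3)[OF \<open>x \<in> X\<close>, of "foldr h v s" b] by simp
next
  case (relator u v r)
  have "foldr h v s \<in> S" using foldr_closed[of "UNIV \<times> X" S h v s] closed relator \<open>s \<in> S\<close> by blast
  then show ?case using assms(4)[OF \<open>r \<in> R\<close>] by simp
qed auto


section \<open>Automorphisms of the universal Cayley extension\<close>

locale pre_extender_loc =
  fixes n :: nat and K :: "'a premaniplex" and rn :: "'a \<Rightarrow> 'a"
  assumes pre_extender: "pre_extender n K rn"
begin

abbreviation "X \<equiv> facets n K"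
abbreviation "R \<equiv> facet_relators n K rn"
abbreviation "G \<equiv> extension_group n K rn"
abbreviation "\<alpha> \<equiv> facet_generator n K rn"
abbreviation "U \<equiv> universal_Cayley_extension n K rn"
abbreviation "H \<equiv> heartsuit n K rn"

section \<open>Flags, adjacencies and facets of the pre-extender\<close>

lemma premaniplex_K: "is_premaniplex n K"
  and connected_K: "premaniplex_connected n K"
  using pre_extender by (auto simp: pre_extender_def is_maniplex_def)

lemma adj_flags: "i < n \<Longrightarrow> \<Phi> \<in> flags K \<Longrightarrow> adj K i \<Phi> \<in> flags K"
  and adj_adj: "i < n \<Longrightarrow> \<Phi> \<in> flags K \<Longrightarrow> adj K i (adj K i \<Phi>) = \<Phi>"
  using premaniplex_K by (auto simp: is_premaniplex_def)

lemma rn_flags: "\<Phi> \<in> flags K \<Longrightarrow> rn \<Phi> \<in> flags K"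
  and rn_rn: "\<Phi> \<in> flags K \<Longrightarrow> rn (rn \<Phi>) = \<Phi>"
  and rn_adj: "i + 1 < n \<Longrightarrow> \<Phi> \<in> flags K \<Longrightarrow> rn (adj K i \<Phi>) = adj K i (rn \<Phi>)"
  using pre_extender by (auto simp: pre_extender_def bij_betw_def)

lemma facet_of_mem: "\<Phi> \<in> facet_of n K \<Phi>"
  by (simp add: facet_of_def component_refl)

lemma facet_of_adj: "i + 1 < n \<Longrightarrow> \<Phi> \<in> flags K \<Longrightarrow> facet_of n K (adj K i \<Phi>) = facet_of n K \<Phi>"
  unfolding facet_of_def by (rule component_adj) (auto intro: adj_flags adj_adj)

lemma rn_facet: "\<Phi> \<in> flags K \<Longrightarrow> rn ` facet_of n K \<Phi> = facet_of n K (rn \<Phi>)"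
  unfolding facet_of_def
  by (rule component_image) (auto intro: adj_flags rn_flags rn_adj)

lemma Aut_facet:
  "\<tau> \<in> Aut n K \<Longrightarrow> \<Phi> \<in> flags K \<Longrightarrow> \<tau> ` facet_of n K \<Phi> = facet_of n K (\<tau> \<Phi>)"
  unfolding facet_of_def using Aut_endo[of \<tau> n K]
  by (intro component_image) (auto intro: adj_flags simp: premaniplex_endo_def)

lemma facets_cases:
  assumes "F \<in> X"
  obtains \<Phi> where "\<Phi> \<in> flags K" "F = facet_of n K \<Phi>"
  using assms by (auto simp: facets_def)

lemma facet_of_facets: "\<Phi> \<in> flags K \<Longrightarrow> facet_of n K \<Phi> \<in> X"
  by (auto simp: facets_def)

lemma rn_facets: "F \<in> X \<Longrightarrow> rn ` F \<in> X"
  by (auto simp: facets_def rn_facet rn_flags)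

lemma rn_rn_facets: "F \<in> X \<Longrightarrow> rn ` rn ` F = F"
  by (erule facets_cases) (simp add: rn_facet rn_flags rn_rn)

lemma Aut_facets: "\<tau> \<in> Aut n K \<Longrightarrow> F \<in> X \<Longrightarrow> \<tau> ` F \<in> X"
  using Aut_endo[of \<tau> n K] by (auto simp: facets_def Aut_facet premaniplex_endo_def)

section \<open>Generators of the extension group\<close>

lemma group_G: "group G"
  unfolding extension_group_def by (rule group_presented_group)

sublocale G: group G
  by (rule group_G)

lemma generator_closed: "F \<in> X \<Longrightarrow> \<alpha> F \<in> carrier G"
  by (auto simp: extension_group_def facet_generator_def presented_group_def)

lemma generator_mult:
  "F \<in> X \<Longrightarrow> u \<in> lists (UNIV \<times> X) \<Longrightarrow> \<alpha> F \<otimes>\<^bsub>G\<^esub> word_class X R u = word_class X R ((True, F) # u)"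
  using mult_word_class[of "[(True, F)]" X u R]
  by (simp add: extension_group_def facet_generator_def)

lemma one_G: "\<one>\<^bsub>G\<^esub> = word_class X R []"
  by (simp add: extension_group_def presented_group_def)

lemma generator_rn:
  assumes "F \<in> X"
  shows "\<alpha> F \<otimes>\<^bsub>G\<^esub> \<alpha> (rn ` F) = \<one>\<^bsub>G\<^esub>"
proof -
  have "word_eq X R ([] @ [(True, F), (True, rn ` F)] @ []) ([] @ [])"
    using assms rn_facets by (intro word_eq.relator) (auto simp: facet_relators_def)
  from word_class_eq[OF this] show ?thesis
    using generator_mult[of F "[(True, rn ` F)]"] assms rn_facets
    by (simp add: one_G) (simp add: facet_generator_def)
qed

lemma generator_rn': "F \<in> X \<Longrightarrow> \<alpha> (rn ` F) \<otimes>\<^bsub>G\<^esub> \<alpha> F = \<one>\<^bsub>G\<^esub>"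
  using generator_rn[of "rn ` F"] by (simp add: rn_facets rn_rn_facets)

lemma generator_rn_cancel:
  "F \<in> X \<Longrightarrow> \<gamma> \<in> carrier G \<Longrightarrow> \<alpha> (rn ` F) \<otimes>\<^bsub>G\<^esub> (\<alpha> F \<otimes>\<^bsub>G\<^esub> \<gamma>) = \<gamma>"
  by (simp add: G.m_assoc[symmetric] generator_closed rn_facets generator_rn')

lemma word_class_False:
  assumes "F \<in> X" "u \<in> lists (UNIV \<times> X)"
  shows "word_class X R ((False, F) # u) = \<alpha> (rn ` F) \<otimes>\<^bsub>G\<^esub> word_class X R u"
proof -
  let ?v = "(False, F) # u"
  have v: "?v \<in> lists (UNIV \<times> X)" "word_class X R ?v \<in> carrier G"
    using assms by (auto simp: extension_group_def presented_group_def)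
  have "word_eq X R ([] @ [(True, F), (\<not> True, F)] @ u) ([] @ u)"
    using assms by (intro word_eq.cancel) auto
  then have "\<alpha> F \<otimes>\<^bsub>G\<^esub> word_class X R ?v = word_class X R u"
    using assms v generator_mult[of F ?v] word_class_eq by fastforce
  then show ?thesis using generator_rn_cancel[OF assms(1) v(2)] by simp
qed

text \<open>The inverse of a generator is again a generator by \<open>word_class_False\<close>, so
  no case for inverses arises.\<close>

lemma G_induct [consumes 1, case_names one generator]:
  assumes "\<gamma> \<in> carrier G" and "P \<one>\<^bsub>G\<^esub>"
    and "\<And>F \<gamma>. F \<in> X \<Longrightarrow> \<gamma> \<in> carrier G \<Longrightarrow> P \<gamma> \<Longrightarrow> P (\<alpha> F \<otimes>\<^bsub>G\<^esub> \<gamma>)"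
  shows "P \<gamma>"
proof -
  obtain w where w: "w \<in> lists (UNIV \<times> X)" "\<gamma> = word_class X R w"
    using assms(1) by (auto simp: extension_group_def presented_group_def)
  have "P (word_class X R w)" using w(1)
  proof (induction w)
    case Nil
    then show ?case using assms(2) by (simp add: one_G)
  next
    case (Cons a w)
    obtain b F where a: "a = (b, F)" by (cases a)
    have F: "F \<in> X" using Cons a by auto
    have "word_class X R w \<in> carrier G"
      using Cons by (auto simp: extension_group_def presented_group_def)
    then show ?case
      using assms(3) F Cons a generator_mult[OF F, of w] word_class_False[OF F, of w] rn_facets
      by (cases b) metis+
  qed
  then show ?thesis using w by simp
qed

section \<open>The universal extension as a connected premaniplex\<close>

lemma flags_U: "flags U = flags K \<times> carrier G"
  by (simp add: universal_Cayley_extension_def)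

lemma adj_U_less: "i < n \<Longrightarrow> adj U i (\<Phi>, \<gamma>) = (adj K i \<Phi>, \<gamma>)"
  by (simp add: universal_Cayley_extension_def)

lemma adj_U_n: "adj U n (\<Phi>, \<gamma>) = (rn \<Phi>, \<alpha> (facet_of n K \<Phi>) \<otimes>\<^bsub>G\<^esub> \<gamma>)"
  by (simp add: universal_Cayley_extension_def)

lemma adj_U_flags: "i < n + 1 \<Longrightarrow> x \<in> flags U \<Longrightarrow> adj U i x \<in> flags U"
  by (cases "i = n"; cases x)
    (auto simp: flags_U adj_U_less adj_U_n adj_flags rn_flags generator_closed facet_of_facets)

text \<open>The second crossing starts in the image facet under \<open>rn\<close>, whose generator
  is inverse to the first one.\<close>

lemma adj_U_n_adj_U_n: "x \<in> flags U \<Longrightarrow> adj U n (adj U n x) = x"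
  by (cases x) (auto simp: flags_U adj_U_n rn_rn generator_rn_cancel facet_of_facets
      simp flip: rn_facet)

text \<open>Colours below \<open>n - 1\<close> stay inside the facet, so both orders multiply by the
  same generator.\<close>

lemma adj_U_comm:
  "i + 1 < n \<Longrightarrow> x \<in> flags U \<Longrightarrow> adj U n (adj U i x) = adj U i (adj U n x)"
  by (cases x) (auto simp: flags_U adj_U_n adj_U_less rn_adj facet_of_adj)

lemma adj_U_adj_U: "i < n + 1 \<Longrightarrow> x \<in> flags U \<Longrightarrow> adj U i (adj U i x) = x"
  by (cases "i = n"; cases x) (auto simp: flags_U adj_U_less adj_adj adj_U_n_adj_U_n)

lemma premaniplex_U: "is_premaniplex (n + 1) U"
  unfolding is_premaniplex_def
proof (intro conjI allI impI ballI)
  fix i j x assume ij: "i < n + 1" "j < n + 1" "\<bar>int i - int j\<bar> > 1" and x: "x \<in> flags U"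
  note fl = adj_U_flags[OF _ x]
  \<comment> \<open>Two colours below \<open>n\<close> inherit the relation from \<open>K\<close>;
    otherwise the gap forces the other colour below \<open>n - 1\<close>, where it commutes with
    colour \<open>n\<close>.\<close>
  consider "i < n" "j < n" | "i = n" "j + 1 < n" | "j = n" "i + 1 < n" using ij by linarith
  then show "adj U i (adj U j (adj U i (adj U j x))) = x"
  proof cases
    case 1
    then show ?thesis using x ij premaniplex_K
      by (cases x) (auto simp: flags_U adj_U_less is_premaniplex_def)
  next
    case 2
    then show ?thesis using x fl[of j] by (simp add: adj_U_comm adj_U_adj_U adj_U_flags)
  next
    case 3
    then show ?thesis using x fl[of n] by (simp add: adj_U_comm adj_U_adj_U adj_U_flags)
  qed
qed (rule adj_U_flags adj_U_adj_U; assumption)+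

text \<open>Connectedness of \<open>K\<close> spreads \<open>P\<close> within a copy; the
  \<open>n\<close>-edge at any flag of \<open>F\<close> carries it to the copy multiplied by the
  generator of \<open>F\<close>, and by \<open>G_induct\<close> this reaches every copy.\<close>

lemma U_induct:
  assumes x: "x \<in> flags U" and \<Phi>: "\<Phi> \<in> flags K" and base: "P (\<Phi>, \<one>\<^bsub>G\<^esub>)"
    and step: "\<And>i x. i < n + 1 \<Longrightarrow> x \<in> flags U \<Longrightarrow> P x \<Longrightarrow> P (adj U i x)"
  shows "P x"
proof -
  have copy: "P (\<Psi>, \<gamma>)"
    if "\<Theta> \<in> flags K" "P (\<Theta>, \<gamma>)" "\<gamma> \<in> carrier G" "\<Psi> \<in> flags K" for \<Theta> \<Psi> \<gamma>
  proof -
    have "P (adj K i \<Xi>, \<gamma>)" if "i < n" "\<Xi> \<in> flags K" "P (\<Xi>, \<gamma>)" for i \<Xi>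
      using step[of i "(\<Xi>, \<gamma>)"] that \<open>\<gamma> \<in> carrier G\<close> by (simp add: flags_U adj_U_less)
    then show ?thesis
      by (rule connected_induct[OF connected_K that(1), of "\<lambda>\<Theta>. P (\<Theta>, \<gamma>)", OF that(2,4)])
  qed
  have "\<forall>\<Psi>\<in>flags K. P (\<Psi>, \<gamma>)" if "\<gamma> \<in> carrier G" for \<gamma>
    using that
  proof (induction rule: G_induct)
    case one
    then show ?case using copy[OF \<Phi> base] by blast
  next
    case (generator F \<gamma>)
    obtain \<Psi> where \<Psi>: "\<Psi> \<in> flags K" "F = facet_of n K \<Psi>" using facets_cases generator(1) .
    then have "P (adj U n (\<Psi>, \<gamma>))" using generator step[of n] by (simp add: flags_U)
    then show ?case
      using copy[of "rn \<Psi>" "\<alpha> F \<otimes>\<^bsub>G\<^esub> \<gamma>"] \<Psi> generator by (simp add: adj_U_n rn_flags generator_closed)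
  qed
  then show ?thesis using x by (auto simp: flags_U)
qed

lemma connected_U: "premaniplex_connected (n + 1) U"
proof -
  obtain \<Phi> where \<Phi>: "\<Phi> \<in> flags K" using connected_K by (auto simp: premaniplex_connected_def)
  let ?C = "component {..<n + 1} U" and ?o = "(\<Phi>, \<one>\<^bsub>G\<^esub>)"
  have "x \<in> ?C ?o" if "x \<in> flags U" for x
    using that \<Phi> by (rule U_induct) (auto intro: component_refl component_step)
  \<comment> \<open>Equality of components turns reachability from the base flag into reachability
    from an arbitrary flag.\<close>
  moreover have "?C x = ?C ?o" if "x \<in> flags U" for x
    using that \<Phi>
    by (rule U_induct) (auto simp: component_adj adj_U_flags adj_U_adj_U)
  moreover have "flags U \<noteq> {}" using \<Phi> by (auto simp: flags_U)
  ultimately show ?thesis by (auto simp: premaniplex_connected_def)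
qed


subsection \<open>Restricting automorphisms to copies\<close>

text \<open>Discarding the group coordinate forgets which copy is reached; \<open>Aut\<close>
  demands maps undefined outside the flags, hence the restriction.\<close>

definition copy_map :: "('a \<times> (bool \<times> 'a set) list set \<Rightarrow> 'a \<times> (bool \<times> 'a set) list set) \<Rightarrow>
    (bool \<times> 'a set) list set \<Rightarrow> 'a \<Rightarrow> 'a" where
  "copy_map \<omega> \<gamma> = (\<lambda>\<Phi>\<in>flags K. fst (\<omega> (\<Phi>, \<gamma>)))"

text \<open>Colours below \<open>n\<close> change only the first coordinate, both before and after
  applying \<omega>.\<close>

lemma copy_endo:
  assumes "premaniplex_endo (n + 1) U \<omega>" "\<gamma> \<in> carrier G"
  shows "premaniplex_endo n K (\<lambda>\<Phi>. fst (\<omega> (\<Phi>, \<gamma>)))"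
  unfolding premaniplex_endo_def
proof (intro conjI allI impI ballI)
  have fl: "\<omega> (\<Phi>, \<gamma>) \<in> flags K \<times> carrier G" if "\<Phi> \<in> flags K" for \<Phi>
    using assms that by (auto simp: premaniplex_endo_def flags_U)
  show "(\<lambda>\<Phi>. fst (\<omega> (\<Phi>, \<gamma>))) ` flags K \<subseteq> flags K"
    using fl by (auto simp: mem_Times_iff)
  fix i \<Phi> assume i: "i < n" "\<Phi> \<in> flags K"
  have "\<omega> (adj U i (\<Phi>, \<gamma>)) = adj U i (\<omega> (\<Phi>, \<gamma>))"
    using assms i by (auto simp: premaniplex_endo_def flags_U)
  then show "fst (\<omega> (adj K i \<Phi>, \<gamma>)) = adj K i (fst (\<omega> (\<Phi>, \<gamma>)))"
    using i by (cases "\<omega> (\<Phi>, \<gamma>)") (simp add: adj_U_less)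
qed

text \<open>The inverse of \<omega>, read on the copy containing the image of one flag, undoes the
  map at that flag, which suffices for \<open>endo_restrict_Aut\<close>.\<close>

lemma copy_Aut:
  assumes \<omega>: "\<omega> \<in> Aut (n + 1) U" and \<gamma>: "\<gamma> \<in> carrier G"
  shows "copy_map \<omega> \<gamma> \<in> Aut n K"
proof -
  obtain \<Phi> where \<Phi>: "\<Phi> \<in> flags K" using connected_K by (auto simp: premaniplex_connected_def)
  define \<omega>' where "\<omega>' = inv\<^bsub>BijGroup (flags U)\<^esub> \<omega>"
  have \<omega>': "\<omega>' \<in> Aut (n + 1) U"
    using subgroup.m_inv_closed[OF subgroup_Aut[OF premaniplex_U] \<omega>] by (simp add: \<omega>'_def)
  have bij: "bij_betw \<omega> (flags U) (flags U)" using \<omega> by (auto simp: Aut_def Bij_def)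
  have mem: "(\<Phi>, \<gamma>) \<in> flags U" using \<Phi> \<gamma> by (simp add: flags_U)
  then have mem': "\<omega> (\<Phi>, \<gamma>) \<in> flags U" using bij by (auto simp: bij_betw_def)
  have inv: "\<omega>' (\<omega> (\<Phi>, \<gamma>)) = (\<Phi>, \<gamma>)"
    using bij mem mem' \<omega> by (simp add: \<omega>'_def inv_BijGroup Aut_def bij_betw_def inv_into_f_f)
  have "snd (\<omega> (\<Phi>, \<gamma>)) \<in> carrier G" using mem' by (auto simp: flags_U mem_Times_iff)
  from endo_restrict_Aut[OF connected_K adj_flags copy_endo[OF Aut_endo[OF \<omega>] \<gamma>]
      copy_endo[OF Aut_endo[OF \<omega>'] this] \<Phi>]
  show ?thesis using inv by (simp add: copy_map_def)
qed

lemma copy_friendly: "friendly n K rn {copy_map \<omega> \<gamma> | \<omega> \<gamma>. \<omega> \<in> Aut (n + 1) U \<and> \<gamma> \<in> carrier G}"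
  (is "friendly n K rn ?S")
  unfolding friendly_def
proof (intro conjI ballI)
  show "?S \<subseteq> Aut n K" using copy_Aut by blast
  fix \<Phi> \<tau> assume \<Phi>: "\<Phi> \<in> flags K" and "\<tau> \<in> ?S"
  then obtain \<omega> \<gamma> where \<omega>: "\<omega> \<in> Aut (n + 1) U" "\<gamma> \<in> carrier G" "\<tau> = copy_map \<omega> \<gamma>" by blast
  \<comment> \<open>The friendly partner of \<tau> is the same \<omega> restricted to the copy at
    the far end of the \<open>n\<close>-edge.\<close>
  let ?\<delta> = "\<alpha> (facet_of n K \<Phi>) \<otimes>\<^bsub>G\<^esub> \<gamma>"
  have "\<omega> (adj U n (\<Phi>, \<gamma>)) = adj U n (\<omega> (\<Phi>, \<gamma>))"
    using Aut_endo[OF \<omega>(1)] \<omega> \<Phi> by (auto simp: premaniplex_endo_def flags_U)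
  then have "rn (\<tau> \<Phi>) = copy_map \<omega> ?\<delta> (rn \<Phi>)"
    using \<Phi> \<omega>(3) by (cases "\<omega> (\<Phi>, \<gamma>)") (simp add: adj_U_n copy_map_def rn_flags)
  moreover have "?\<delta> \<in> carrier G" using \<omega> \<Phi> by (simp add: generator_closed facet_of_facets)
  ultimately show "\<exists>\<tau>'\<in>?S. rn (\<tau> \<Phi>) = \<tau>' (rn \<Phi>)" using \<omega>(1) by blast
qed

lemma copy_heartsuit: "\<omega> \<in> Aut (n + 1) U \<Longrightarrow> \<gamma> \<in> carrier G \<Longrightarrow> copy_map \<omega> \<gamma> \<in> H"
  unfolding heartsuit_def using copy_friendly by blast


subsection \<open>Lifting the greatest friendly subgroup\<close>

lemma H_Aut: "\<tau> \<in> H \<Longrightarrow> \<tau> \<in> Aut n K"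
  using friendly_heartsuit[of n K rn] by (auto simp: friendly_def)

lemma H_flags: "\<tau> \<in> H \<Longrightarrow> \<Phi> \<in> flags K \<Longrightarrow> \<tau> \<Phi> \<in> flags K"
  using Aut_endo[OF H_Aut, of \<tau>] by (auto simp: premaniplex_endo_def)

lemma H_adj: "\<tau> \<in> H \<Longrightarrow> i < n \<Longrightarrow> \<Phi> \<in> flags K \<Longrightarrow> \<tau> (adj K i \<Phi>) = adj K i (\<tau> \<Phi>)"
  using Aut_endo[OF H_Aut, of \<tau>] by (auto simp: premaniplex_endo_def)

text \<open>For a facet \<open>F\<close> and \<tau> in \<open>H\<close> the choice is unique:
  \<open>F\<close> is nonempty, and \<open>Aut_eq\<close> identifies automorphisms agreeing at one
  flag.\<close>

definition cross :: "'a set \<Rightarrow> ('a \<Rightarrow> 'a) \<Rightarrow> ('a \<Rightarrow> 'a)" where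
  "cross F \<tau> = (SOME \<tau>'. \<tau>' \<in> H \<and> (\<forall>\<Phi>\<in>F. \<tau>' (rn \<Phi>) = rn (\<tau> \<Phi>)))"

text \<open>Friendliness gives a partner at a single flag. It serves the whole facet because the
  colours below \<open>n - 1\<close> connect \<open>F\<close> and commute with \<open>rn\<close> and
  with both automorphisms.\<close>

lemma
  assumes "F \<in> X" and \<tau>: "\<tau> \<in> H"
  shows cross_H: "cross F \<tau> \<in> H"
    and cross_rn: "\<Phi> \<in> F \<Longrightarrow> cross F \<tau> (rn \<Phi>) = rn (\<tau> \<Phi>)"
proof -
  obtain \<Phi>0 where \<Phi>0: "\<Phi>0 \<in> flags K" "F = facet_of n K \<Phi>0" using facets_cases assms(1) .
  obtain \<tau>' where \<tau>': "\<tau>' \<in> H" "rn (\<tau> \<Phi>0) = \<tau>' (rn \<Phi>0)"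
    using friendly_heartsuit[of n K rn] \<Phi>0 \<tau> unfolding friendly_def by blast
  have "\<tau>' (rn \<Phi>) = rn (\<tau> \<Phi>)" if "\<Phi> \<in> F" for \<Phi>
    using that unfolding \<Phi>0(2) facet_of_def
  proof (induction rule: component_induct)
    case base
    then show ?case using \<tau>' by simp
  next
    case (step i \<Theta>)
    then have "i + 1 < n" "i < n" by auto
    then show ?case using step \<tau> \<tau>' by (simp add: rn_adj H_adj H_flags rn_flags)
  qed
  then have "\<exists>\<tau>'. \<tau>' \<in> H \<and> (\<forall>\<Phi>\<in>F. \<tau>' (rn \<Phi>) = rn (\<tau> \<Phi>))" using \<tau>' by blast
  then have "cross F \<tau> \<in> H \<and> (\<forall>\<Phi>\<in>F. cross F \<tau> (rn \<Phi>) = rn (\<tau> \<Phi>))"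
    unfolding cross_def by (rule someI_ex)
  then show "cross F \<tau> \<in> H" "\<Phi> \<in> F \<Longrightarrow> cross F \<tau> (rn \<Phi>) = rn (\<tau> \<Phi>)" by blast+
qed

text \<open>Both sides are automorphisms, and they agree at a flag of \<open>F\<close> because
  \<open>rn\<close> is an involution.\<close>

lemma cross_cross:
  assumes F: "F \<in> X" and \<tau>: "\<tau> \<in> H"
  shows "cross (rn ` F) (cross F \<tau>) = \<tau>"
proof -
  obtain \<Phi> where \<Phi>: "\<Phi> \<in> flags K" "F = facet_of n K \<Phi>" using facets_cases F .
  then have \<Phi>F: "\<Phi> \<in> F" by (simp add: facet_of_mem)
  have "cross (rn ` F) (cross F \<tau>) (rn (rn \<Phi>)) = rn (cross F \<tau> (rn \<Phi>))"
    using \<Phi>F F \<tau> by (intro cross_rn) (auto simp: rn_facets cross_H)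
  also have "\<dots> = \<tau> \<Phi>" using \<Phi> \<Phi>F F \<tau> by (simp add: cross_rn rn_rn H_flags)
  finally show ?thesis
    using \<Phi> F \<tau> by (intro Aut_eq[OF connected_K _ _ \<Phi>(1)]) (auto simp: rn_rn cross_H rn_facets H_Aut)
qed

text \<open>Used in \<open>move_rn\<close>: crossing back multiplies by the generator of this facet,
  which is inverse to the one used on the way out.\<close>

lemma cross_facet:
  assumes F: "F \<in> X" and \<tau>: "\<tau> \<in> H"
  shows "cross F \<tau> ` rn ` F = rn ` \<tau> ` F"
  using cross_rn[OF F \<tau>] by (force simp: image_image)

text \<open>The state (\<tau>, \<delta>) of a copy says that it is mapped by \<tau> onto copy
  \<delta>; a move yields the state of the neighbour across \<open>F\<close>. An inverse letter acts
  as the image facet under \<open>rn\<close>, matching the inverse generator.\<close>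

definition move :: "bool \<times> 'a set \<Rightarrow> ('a \<Rightarrow> 'a) \<times> (bool \<times> 'a set) list set \<Rightarrow>
    ('a \<Rightarrow> 'a) \<times> (bool \<times> 'a set) list set" where
  "move = (\<lambda>(b, F) (\<tau>, \<delta>). let F' = if b then F else rn ` F in (cross F' \<tau>, \<alpha> (\<tau> ` F') \<otimes>\<^bsub>G\<^esub> \<delta>))"

lemma move_False: "move (False, F) = move (True, rn ` F)"
  by (simp add: move_def)

lemma move_closed: "F \<in> X \<Longrightarrow> s \<in> H \<times> carrier G \<Longrightarrow> move (b, F) s \<in> H \<times> carrier G"
  by (cases s) (auto simp: move_def Let_def cross_H rn_facets generator_closed Aut_facets H_Aut)

lemma move_rn: "F \<in> X \<Longrightarrow> s \<in> H \<times> carrier G \<Longrightarrow> move (True, rn ` F) (move (True, F) s) = s"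
  by (cases s) (auto simp: move_def cross_cross cross_facet generator_rn_cancel Aut_facets H_Aut)

lemma move_rn': "F \<in> X \<Longrightarrow> s \<in> H \<times> carrier G \<Longrightarrow> move (True, F) (move (True, rn ` F) s) = s"
  using move_rn[of "rn ` F" s] by (simp add: rn_facets rn_rn_facets)

lemma move_word_eq:
  assumes "word_eq X R u v" "s \<in> H \<times> carrier G"
  shows "foldr move u s = foldr move v s"
  using assms(1)
proof (rule word_eq_foldr[where S = "H \<times> carrier G"])
  show "move (b, x) (move (\<not> b, x) s) = s" if "x \<in> X" "s \<in> H \<times> carrier G" for b x s
    using that by (cases b) (auto simp: move_False move_rn move_rn' simp del: mem_Sigma_iff)
  show "foldr move r s = s" if "r \<in> R" "s \<in> H \<times> carrier G" for r s
  proof -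
    obtain F where "F \<in> X" "r = [(True, F), (True, rn ` F)]"
      using \<open>r \<in> R\<close> by (auto simp: facet_relators_def)
    then show ?thesis using that(2) by (simp add: move_rn' del: mem_Sigma_iff)
  qed
qed (use assms(2) move_closed in auto)

text \<open>Group elements are classes of words, so a representative is chosen;
  \<open>move_word_eq\<close> makes the result independent of it. The value is the state of copy
  \<gamma> when the identity copy has state \<open>s\<close>.\<close>

definition act :: "('a \<Rightarrow> 'a) \<times> (bool \<times> 'a set) list set \<Rightarrow> (bool \<times> 'a set) list set \<Rightarrow>
    ('a \<Rightarrow> 'a) \<times> (bool \<times> 'a set) list set" where
  "act s \<gamma> = foldr move (SOME w. w \<in> \<gamma>) s"

lemma act_word_class:
  assumes "s \<in> H \<times> carrier G" "w \<in> lists (UNIV \<times> X)"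
  shows "act s (word_class X R w) = foldr move w s"
proof -
  have "w \<in> word_class X R w" using assms(2) by (auto simp: word_class_def intro: word_eq.refl)
  then have "word_eq X R w (SOME v. v \<in> word_class X R w)"
    by (metis someI word_class_def mem_Collect_eq)
  from move_word_eq[OF this assms(1)] show ?thesis by (simp add: act_def)
qed

lemma act_one: "s \<in> H \<times> carrier G \<Longrightarrow> act s \<one>\<^bsub>G\<^esub> = s"
  by (simp add: one_G act_word_class)

lemma act_generator:
  assumes s: "s \<in> H \<times> carrier G" and F: "F \<in> X" and \<gamma>: "\<gamma> \<in> carrier G"
  shows "act s (\<alpha> F \<otimes>\<^bsub>G\<^esub> \<gamma>) = move (True, F) (act s \<gamma>)"
proof -
  obtain w where w: "w \<in> lists (UNIV \<times> X)" "\<gamma> = word_class X R w"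
    using \<gamma> by (auto simp: extension_group_def presented_group_def)
  moreover have "(True, F) # w \<in> lists (UNIV \<times> X)" using w F by auto
  ultimately show ?thesis
    using s F by (simp add: generator_mult act_word_class del: in_lists_conv_set mem_Sigma_iff)
qed

lemma act_closed: "\<gamma> \<in> carrier G \<Longrightarrow> s \<in> H \<times> carrier G \<Longrightarrow> act s \<gamma> \<in> H \<times> carrier G"
  by (induction rule: G_induct) (simp_all add: act_one act_generator move_closed del: mem_Sigma_iff)

definition lift :: "('a \<Rightarrow> 'a) \<times> (bool \<times> 'a set) list set \<Rightarrow>
    'a \<times> (bool \<times> 'a set) list set \<Rightarrow> 'a \<times> (bool \<times> 'a set) list set" where
  "lift s = (\<lambda>(\<Phi>, \<gamma>). (fst (act s \<gamma>) \<Phi>, snd (act s \<gamma>)))"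

lemma lift_endo:
  assumes s: "s \<in> H \<times> carrier G"
  shows "premaniplex_endo (n + 1) U (lift s)"
proof -
  have "lift s (\<Phi>, \<gamma>) \<in> flags U" and "lift s (adj U i (\<Phi>, \<gamma>)) = adj U i (lift s (\<Phi>, \<gamma>))"
    if \<Phi>: "\<Phi> \<in> flags K" and \<gamma>: "\<gamma> \<in> carrier G" and i: "i < n + 1" for \<Phi> \<gamma> i
  proof -
    obtain \<tau> \<delta> where act: "act s \<gamma> = (\<tau>, \<delta>)" "\<tau> \<in> H" "\<delta> \<in> carrier G"
      using act_closed[OF \<gamma> s] by auto
    show "lift s (\<Phi>, \<gamma>) \<in> flags U" using act \<Phi> by (simp add: lift_def flags_U H_flags)
    show "lift s (adj U i (\<Phi>, \<gamma>)) = adj U i (lift s (\<Phi>, \<gamma>))"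
    proof (cases "i = n")
      case True
      \<comment> \<open>\<open>move\<close> is shaped for this case: \<open>cross_rn\<close> matches
        the first coordinates and \<open>Aut_facet\<close> the generators.\<close>
      then show ?thesis using act \<Phi> \<gamma> s
        by (simp add: lift_def adj_U_n act_generator facet_of_facets move_def cross_rn facet_of_mem
            Aut_facet H_Aut del: mem_Sigma_iff)
    next
      case False
      then show ?thesis using act \<Phi> i by (simp add: lift_def adj_U_less H_adj)
    qed
  qed
  then show ?thesis by (fastforce simp: premaniplex_endo_def flags_U)
qed

text \<open>Moves are invertible, so a state prescribed at copy \<gamma> can be traced back to the
  identity copy, where \<open>lift\<close> starts.\<close>

lemma act_surj:
  assumes "\<gamma> \<in> carrier G" "t \<in> H \<times> carrier G"
  shows "\<exists>s\<in>H \<times> carrier G. act s \<gamma> = t"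
  using assms
proof (induction arbitrary: t rule: G_induct)
  case one
  then show ?case using act_one by blast
next
  case (generator F \<gamma>)
  then obtain s where "s \<in> H \<times> carrier G" "act s \<gamma> = move (True, rn ` F) t"
    using move_closed rn_facets by meson
  then show ?case using generator by (metis act_generator move_rn')
qed

lemma lift_Aut:
  assumes \<tau>: "\<tau> \<in> H" and \<delta>: "\<delta> \<in> carrier G" and \<gamma>: "\<gamma> \<in> carrier G" and \<Phi>: "\<Phi> \<in> flags K"
  shows "\<exists>\<omega>\<in>Aut (n + 1) U. \<omega> (\<Phi>, \<gamma>) = (\<tau> \<Phi>, \<delta>)"
proof -
  let ?\<tau>' = "inv\<^bsub>BijGroup (flags K)\<^esub> \<tau>"
  have bij: "\<tau> \<in> Bij (flags K)" using H_Aut[OF \<tau>] by (simp add: Aut_def)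
  have \<tau>': "?\<tau>' \<in> H" using subgroup.m_inv_closed[OF subgroup_heartsuit[OF pre_extender] \<tau>] .
  have inv: "?\<tau>' (\<tau> \<Phi>) = \<Phi>"
    using bij \<Phi> H_flags[OF \<tau> \<Phi>] by (simp add: inv_BijGroup Bij_def bij_betw_def inv_into_f_f)
  \<comment> \<open>The lift of \<open>s\<close> sends copy \<gamma> to copy \<delta> by \<tau>, and
    the lift of \<open>t\<close> sends copy \<delta> back by the inverse of \<tau>. Their composite
    fixes one flag, as \<open>endo_restrict_Aut\<close> requires.\<close>
  obtain s where s: "s \<in> H \<times> carrier G" "act s \<gamma> = (\<tau>, \<delta>)" using act_surj \<tau> \<delta> \<gamma> by blast
  obtain t where t: "t \<in> H \<times> carrier G" "act t \<delta> = (?\<tau>', \<gamma>)" using act_surj \<tau>' \<delta> \<gamma> by blast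
  have mem: "(\<Phi>, \<gamma>) \<in> flags U" using \<Phi> \<gamma> by (simp add: flags_U)
  have "lift t (lift s (\<Phi>, \<gamma>)) = (\<Phi>, \<gamma>)" using s t inv by (simp add: lift_def)
  from endo_restrict_Aut[OF connected_U adj_U_flags lift_endo[OF s(1)] lift_endo[OF t(1)] mem this]
  show ?thesis using mem s by (intro bexI) (auto simp: lift_def)
qed

section \<open>Orbits of flags and the final isomorphism\<close>

lemma orb_U:
  assumes \<Phi>: "\<Phi> \<in> flags K" and \<gamma>: "\<gamma> \<in> carrier G"
  shows "orb (Aut (n + 1) U) (\<Phi>, \<gamma>) = orb H \<Phi> \<times> carrier G"
proof (intro equalityI subsetI)
  fix x assume "x \<in> orb (Aut (n + 1) U) (\<Phi>, \<gamma>)"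
  then obtain \<omega> where \<omega>: "\<omega> \<in> Aut (n + 1) U" "x = \<omega> (\<Phi>, \<gamma>)" by (auto simp: orb_def)
  then have "x \<in> flags U" using Aut_endo[OF \<omega>(1)] \<Phi> \<gamma> by (auto simp: premaniplex_endo_def flags_U)
  moreover have "fst x = copy_map \<omega> \<gamma> \<Phi>" using \<omega> \<Phi> by (simp add: copy_map_def)
  ultimately show "x \<in> orb H \<Phi> \<times> carrier G"
    using copy_heartsuit[OF \<omega>(1) \<gamma>] by (auto simp: orb_def flags_U mem_Times_iff)
next
  \<comment> \<open>The element of \<open>H\<close> and the target copy can be prescribed
    independently.\<close>
  fix x assume "x \<in> orb H \<Phi> \<times> carrier G"
  then obtain \<tau> \<delta> where "\<tau> \<in> H" "\<delta> \<in> carrier G" "x = (\<tau> \<Phi>, \<delta>)" by (auto simp: orb_def)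
  moreover from this obtain \<omega> where "\<omega> \<in> Aut (n + 1) U" "\<omega> (\<Phi>, \<gamma>) = (\<tau> \<Phi>, \<delta>)"
    using lift_Aut \<Phi> \<gamma> by blast
  ultimately show "x \<in> orb (Aut (n + 1) U) (\<Phi>, \<gamma>)"
    unfolding orb_def mem_Collect_eq by metis
qed

text \<open>By \<open>orb_U\<close> every orbit is a product with the full group, so projecting it
  to the first factor loses nothing.\<close>

lemma symmetry_type_graph_iso:
  "premaniplex_iso (n + 1) (symmetry_type_graph (n + 1) U)
     (quotient_premaniplex (pre_extension n K rn) H) ((`) fst)"
  (is "premaniplex_iso _ ?S ?Q _")
proof -
  \<comment> \<open>An empty second factor would make every projection empty.\<close>
  have ne: "carrier G \<noteq> {}" using G.one_closed by blast
  then have fst: "fst ` (A \<times> carrier G) = A" for A :: "'a set" by auto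
  have flags_S: "flags ?S = (\<lambda>\<Phi>. orb H \<Phi> \<times> carrier G) ` flags K"
  proof -
    have "flags ?S = (\<lambda>(\<Phi>, \<gamma>). orb H \<Phi> \<times> carrier G) ` (flags K \<times> carrier G)"
      unfolding symmetry_type_graph_def quotient_premaniplex_def
      by (simp add: flags_U) (intro image_cong, auto simp: orb_U[simplified])
    then show ?thesis using ne by (force simp: image_iff)
  qed
  have flags_Q: "flags ?Q = orb H ` flags K"
    by (simp add: quotient_premaniplex_def pre_extension_def)
  have "fst ` adj ?S i (orb H \<Phi> \<times> carrier G) = adj ?Q i (orb H \<Phi>)"
    if i: "i < n + 1" and \<Phi>: "\<Phi> \<in> flags K" for i \<Phi>
  proof -
    \<comment> \<open>The orbit does not depend on the group coordinate, so the identity copy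
      supplies a representative from which to compute the neighbour.\<close>
    let ?x = "(\<Phi>, \<one>\<^bsub>G\<^esub>)"
    have x: "?x \<in> flags U" using \<Phi> by (simp add: flags_U)
    have y: "fst (adj U i ?x) = adj (pre_extension n K rn) i \<Phi>"
      by (simp add: universal_Cayley_extension_def pre_extension_def)
    have "adj U i ?x \<in> flags K \<times> carrier G" using adj_U_flags[OF i x] by (simp add: flags_U)
    then have "orb (Aut (n + 1) U) (adj U i ?x) = orb H (fst (adj U i ?x)) \<times> carrier G"
      by (metis orb_U mem_Times_iff prod.collapse)
    then show ?thesis
      using adj_quotient_Aut[OF premaniplex_U i x] orb_U[OF \<Phi> G.one_closed] y i
        adj_quotient_friendly[OF pre_extender friendly_heartsuit subgroup_heartsuit[OF pre_extender] _ \<Phi>]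
      by (simp add: fst ne)
  qed
  moreover have "bij_betw ((`) fst) (flags ?S) (flags ?Q)"
    unfolding flags_S flags_Q by (auto simp: bij_betw_def inj_on_def fst image_image)
  ultimately show ?thesis unfolding premaniplex_iso_def flags_S by (simp add: fst ne)
qed

end

theorem theorem5p19:
  fixes n :: nat and K :: "'a premaniplex" and rn :: "'a \<Rightarrow> 'a"
  assumes "pre_extender n K rn"
  shows "premaniplex_isomorphic (n + 1)
           (symmetry_type_graph (n + 1) (universal_Cayley_extension n K rn))
           (quotient_premaniplex (pre_extension n K rn) (heartsuit n K rn))"
proof -
  interpret pre_extender_loc n K rn by (rule pre_extender_loc.intro[OF assms])
  show ?thesis unfolding premaniplex_isomorphic_def using symmetry_type_graph_iso by blast
qed

end
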